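(* If $p \ge 3$ and $n \ge 2$ are integers, then the game total domination number $\gamma_{\rm tg}(S_p^n)$ and the Staller start game total domination number $\gamma_{\rm tg}'(S_p^n)$ of the Sierpiński graph $S_p^n$ satisfy $$\gamma_{\rm tg}(S_p^n) \ge (2p-2)p^{n-2} \quad\text{and}\quad \gamma_{\rm tg}'(S_p^n) \ge (2p-2)p^{n-2}.$$
   Context: Write $[p]=\{1,\dots,p\}$. For $p\ge 3$ and $n\ge 1$, the Sierpiński graph $S_p^n$ has vertex set $[p]^n$, with $(i_1,\dots,i_n)$ written as $i_1\cdots i_n$. Vertices $i_1\cdots i_n$ and $j_1\cdots j_n$ are adjacent if there exists an index $h\in\{1,\dots,n\}$ such that (i) $i_t=j_t$ for every $t<h$, (ii) $i_h\ne j_h$, and (iii) $i_t=j_h$ and $j_t=i_h$ for every $t>h$. A vertex totally dominates its neighbours (but not itself). The total domination game on a graph $G$ is played by two players, Dominator and Staller, who alternately choose vertices of $G$ such that each newly chosen vertex totally dominates at least one vertex not totally dominated by the previously chosen vertices. The game ends when no such vertex is available. Dominator wants the total number of chosen vertices (moves) to be as small as possible, Staller wants it to be as large as possible. The game total domination number $\gamma_{\rm tg}(G)$ is the number of moves when Dominator moves first (D-game) and both players play optimally. The Staller start game total domination number $\gamma_{\rm tg}'(G)$ is the number of moves when Staller moves first (S-game) and both players play optimally. *)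

theory Defs
  imports "Graph_Theory.Pair_Digraph"
begin

text \<open>
  Graphs are symmetric pair digraphs of the AFP entry Graph Theory: an undirected edge between
  \<open>u\<close> and \<open>v\<close> is represented by the two arcs \<open>(u, v)\<close> and \<open>(v, u)\<close>.
\<close>

section \<open>Sierpinski graphs\<close>

text \<open>
  A vertex \<open>i\<^sub>1 \<dots> i\<^sub>n\<close> is the list \<open>[i\<^sub>1, \<dots>, i\<^sub>n]\<close>. List positions are
  numbered from 0, so the index \<open>h\<close> below is one less than the usual one.
\<close>

definition sierpinski_verts :: "nat \<Rightarrow> nat \<Rightarrow> nat list set" where
  "sierpinski_verts p n = {xs. length xs = n \<and> set xs \<subseteq> {1..p}}"

definition sierpinski_adj :: "nat \<Rightarrow> nat list \<Rightarrow> nat list \<Rightarrow> bool" where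
  "sierpinski_adj n i j \<longleftrightarrow>
     (\<exists>h<n. (\<forall>t<h. i ! t = j ! t) \<and> i ! h \<noteq> j ! h \<and>
            (\<forall>t. h < t \<and> t < n \<longrightarrow> i ! t = j ! h \<and> j ! t = i ! h))"

definition sierpinski :: "nat \<Rightarrow> nat \<Rightarrow> nat list pair_pre_digraph" where
  "sierpinski p n =
     \<lparr> pverts = sierpinski_verts p n,
       parcs = {(i, j). i \<in> sierpinski_verts p n \<and> j \<in> sierpinski_verts p n \<and>
                        sierpinski_adj n i j} \<rparr>"

lemma sierpinski_adj_sym: "sierpinski_adj n i j \<Longrightarrow> sierpinski_adj n j i"
  unfolding sierpinski_adj_def by metis

lemma finite_sierpinski_verts: "finite (sierpinski_verts p n)"
proof -
  have "sierpinski_verts p n = {xs. set xs \<subseteq> {1..p} \<and> length xs = n}"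
    by (auto simp: sierpinski_verts_def)
  thus ?thesis using finite_lists_length_eq[of "{1..p}" n] by simp
qed

lemma pair_graph_sierpinski: "pair_graph (sierpinski p n)"
proof
  have "parcs (sierpinski p n) \<subseteq> sierpinski_verts p n \<times> sierpinski_verts p n"
    by (auto simp: sierpinski_def)
  thus "finite (parcs (sierpinski p n))"
    using finite_sierpinski_verts finite_subset by blast
  show "finite (pverts (sierpinski p n))"
    by (simp add: sierpinski_def finite_sierpinski_verts)
  show "symmetric (with_proj (sierpinski p n))"
    by (auto simp: symmetric_def sym_def sierpinski_def arcs_ends_def arc_to_ends_def
             intro: sierpinski_adj_sym)
qed (auto simp: sierpinski_def sierpinski_adj_def)

section \<open>The total domination game\<close>

definition total_dom :: "'a pair_pre_digraph \<Rightarrow> 'a \<Rightarrow> 'a set" where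
  "total_dom G v = {w \<in> pverts G. (v, w) \<in> parcs G}"

text \<open>The vertices that may be chosen next when the set of previously chosen vertices is \<open>X\<close>.\<close>

definition legal_moves :: "'a pair_pre_digraph \<Rightarrow> 'a set \<Rightarrow> 'a set" where
  "legal_moves G X = {v \<in> pverts G. \<exists>w \<in> total_dom G v. \<forall>x \<in> X. w \<notin> total_dom G x}"

lemma legal_moves_fresh: "v \<in> legal_moves G X \<Longrightarrow> v \<in> pverts G - X"
  unfolding legal_moves_def by blast

datatype player = Dominator | Staller

text \<open>
  \<open>tdg_moves G P X\<close> is the number of moves still to be made under optimal play when it is the
  turn of player \<open>P\<close> and \<open>X\<close> is the set of vertices chosen so far. The
  finiteness test only serves to make the recursion total; the game is meant to be played on
  finite graphs.
\<close>

function tdg_moves :: "'a pair_pre_digraph \<Rightarrow> player \<Rightarrow> 'a set \<Rightarrow> nat" where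
  "tdg_moves G Dominator X =
     (if infinite (pverts G) \<or> legal_moves G X = {} then 0
      else Min ((\<lambda>v. 1 + tdg_moves G Staller (insert v X)) ` legal_moves G X))"
| "tdg_moves G Staller X =
     (if infinite (pverts G) \<or> legal_moves G X = {} then 0
      else Max ((\<lambda>v. 1 + tdg_moves G Dominator (insert v X)) ` legal_moves G X))"
  by pat_completeness auto

termination
proof (relation "measure (\<lambda>(G, P, X). card (pverts G - X))", goal_cases)
  case 1
  show ?case by simp
next
  case (2 G X v)
  hence "pverts G - insert v X \<subset> pverts G - X" using legal_moves_fresh by fastforce
  thus ?case using 2 by (simp add: psubset_card_mono)
next
  case (3 G X v)
  hence "pverts G - insert v X \<subset> pverts G - X" using legal_moves_fresh by fastforce
  thus ?case using 3 by (simp add: psubset_card_mono)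
qed

declare tdg_moves.simps [simp del]

definition gamma_tg :: "'a pair_pre_digraph \<Rightarrow> nat" where
  "gamma_tg G = tdg_moves G Dominator {}"

definition gamma_tg' :: "'a pair_pre_digraph \<Rightarrow> nat" where
  "gamma_tg' G = tdg_moves G Staller {}"

end

theory Submission
  imports Defs
begin

text \<open>
  For \<open>n = m + 2\<close> the vertices of the graph are the words \<open>b @ [i, j]\<close>: the prefix \<open>b\<close>, of length \<open>m\<close>,
  names one of \<open>p ^ m\<close> copies of \<open>S\<^sub>p\<^sup>2\<close>, and \<open>i\<close> names one of the \<open>p\<close> cliques \<open>K\<^sub>p\<close> of that copy. Inside a
  copy any two cliques \<open>i\<close> and \<open>t\<close> are joined by the single edge from \<open>b @ [i, t]\<close> to \<open>b @ [t, i]\<close>, and an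
  off-diagonal vertex has only one neighbour outside its own clique, the other end of that edge.

  Call a clique untouched as long as none of its vertices has been chosen. The progress of the game
  is measured by the \<open>deficit\<close>: the sum over all copies of the number of untouched cliques minus one
  (truncated at 0). It starts at \<open>(p - 1) * p ^ m\<close>, every move lowers it by at most one, and the game
  cannot stop while it is positive, because the edge between two untouched cliques of the same copy
  has undominated ends. Staller prevents a round (a move of Dominator and her reply) from lowering
  it by two. If Dominator's move lowers the deficit, she answers in the clique that he has just
  entered; a legal answer exists there (\<open>reply_in_same_clique\<close>), precisely because another clique
  of the copy is still untouched. If his move does not lower the deficit, she may lower it herself.
  This gives \<open>2 * deficit\<close> moves when Dominator is to move.

  When Staller starts, her own first move costs one unit of the deficit, so one further move has to
  be found. It comes from the property \<open>has_tempo\<close>: in some copy there are untouched cliques, and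
  also a touched clique none of whose chosen vertices is joined to one of them. While it
  holds, some vertex is undominated, so the game continues even at deficit 0. Staller creates this
  situation by choosing a diagonal vertex \<open>b @ [i, i]\<close> of an untouched clique (\<open>diagonal_move\<close>), and it
  survives each round in which Dominator lowers the deficit (\<open>has_tempo_preserved\<close>). A move of
  Dominator that does not lower the deficit may destroy it; but at a positive deficit Staller then
  creates it again, and at deficit 0 that move is itself the additional one. Hence
  \<open>2 * deficit + 1\<close> moves remain whenever it holds on Dominator's turn (\<open>tdg_moves_lower_bound\<close>).
\<close>

section \<open>Adjacency at the level of the cliques\<close>

lemma sierpinski_verts_Suc_Suc:
  "v \<in> sierpinski_verts p (m + 2) \<longleftrightarrow>
     (\<exists>b\<in>sierpinski_verts p m. \<exists>i\<in>{1..p}. \<exists>j\<in>{1..p}. v = b @ [i, j])" (is "?L \<longleftrightarrow> ?R")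
proof
  assume L: ?L
  hence len: "length v = m + 2" and sub: "set v \<subseteq> {1..p}"
    by (auto simp: sierpinski_verts_def)
  have "v = take m v @ drop m v" by simp
  moreover have "length (drop m v) = Suc (Suc 0)" using len by simp
  then obtain i j where "drop m v = [i, j]"
    by (auto simp: length_Suc_conv simp del: length_drop)
  ultimately have v: "v = take m v @ [i, j]" by simp
  have "take m v \<in> sierpinski_verts p m"
    using len sub set_take_subset[of m v] by (auto simp: sierpinski_verts_def)
  moreover have "i \<in> set v" "j \<in> set v" by (subst v, simp)+
  ultimately show ?R using v sub by blast
qed (auto simp: sierpinski_verts_def)

lemma adj_same_clique:
  assumes "length b = m" "j \<noteq> k"
  shows "sierpinski_adj (m + 2) (b @ [i, j]) (b @ [i, k])"
  unfolding sierpinski_adj_def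
  by (rule exI[of _ "m + 1"]) (use assms in \<open>auto simp: nth_append\<close>)

lemma adj_between_cliques:
  assumes "length b = m" "i \<noteq> j"
  shows "sierpinski_adj (m + 2) (b @ [i, j]) (b @ [j, i])"
proof -
  have "t = m + 1" if "m < t" "t < m + 2" for t using that by linarith
  thus ?thesis unfolding sierpinski_adj_def
    by (intro exI[of _ m]) (use assms in \<open>auto simp: nth_append\<close>)
qed

text \<open>
  If the words differed at a position inside the prefix, all later letters of \<open>b @ [i, j]\<close> would
  coincide, contrary to \<open>i \<noteq> j\<close>. So only the last two positions are left.
\<close>

lemma adj_off_diagonalD:
  assumes adj: "sierpinski_adj (m + 2) (b @ [i, j]) (c @ [k, l])"
    and len: "length b = m" "length c = m" and "i \<noteq> j"
  shows "c = b \<and> (k = i \<or> (k = j \<and> l = i))"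
proof -
  from adj obtain h where h: "h < m + 2"
    and eq: "\<And>t. t < h \<Longrightarrow> (b @ [i, j]) ! t = (c @ [k, l]) ! t"
    and swap: "\<And>t. h < t \<Longrightarrow> t < m + 2 \<Longrightarrow>
       (b @ [i, j]) ! t = (c @ [k, l]) ! h \<and> (c @ [k, l]) ! t = (b @ [i, j]) ! h"
    unfolding sierpinski_adj_def by blast
  have "\<not> h < m"
  proof
    assume "h < m"
    from swap[of m] swap[of "m + 1"] this len have "i = j" by (simp add: nth_append)
    with \<open>i \<noteq> j\<close> show False ..
  qed
  have "c = b"
  proof (rule nth_equalityI)
    fix t assume "t < length c"
    with eq[of t] \<open>\<not> h < m\<close> len show "c ! t = b ! t" by (simp add: nth_append)
  qed (use len in simp)
  moreover from h \<open>\<not> h < m\<close> have "h = m \<or> h = m + 1" by linarith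
  hence "k = i \<or> (k = j \<and> l = i)"
  proof
    assume "h = m"
    with swap[of "m + 1"] len show ?thesis by (simp add: nth_append)
  next
    assume "h = m + 1"
    with eq[of m] len show ?thesis by (simp add: nth_append)
  qed
  ultimately show ?thesis by blast
qed

lemma mem_total_dom_sierpinski:
  "w \<in> total_dom (sierpinski p n) v \<longleftrightarrow>
     v \<in> sierpinski_verts p n \<and> w \<in> sierpinski_verts p n \<and> sierpinski_adj n v w"
  by (auto simp: total_dom_def sierpinski_def)

section \<open>Untouched cliques and legal moves\<close>

definition untouched_cliques :: "nat \<Rightarrow> nat list \<Rightarrow> nat list set \<Rightarrow> nat set" where
  "untouched_cliques p b X = {i \<in> {1..p}. \<forall>j. b @ [i, j] \<notin> X}"

lemma finite_untouched_cliques [simp]: "finite (untouched_cliques p b X)"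
  by (simp add: untouched_cliques_def)

lemma untouched_cliques_insert:
  "untouched_cliques p c (insert (b @ [i, j]) X) =
     (if c = b then untouched_cliques p b X - {i} else untouched_cliques p c X)"
  by (auto simp: untouched_cliques_def)

definition undominated :: "nat \<Rightarrow> nat \<Rightarrow> nat list set \<Rightarrow> nat list \<Rightarrow> bool" where
  "undominated p m X w \<longleftrightarrow> w \<in> sierpinski_verts p (m + 2) \<and>
     (\<forall>x\<in>X. w \<notin> total_dom (sierpinski p (m + 2)) x)"

lemma undominated_in_untouched_clique:
  assumes "b \<in> sierpinski_verts p m" "i \<in> {1..p}"
    and t: "t \<in> untouched_cliques p b X" and "i \<noteq> t" and it: "b @ [i, t] \<notin> X"
  shows "undominated p m X (b @ [t, i])"
  unfolding undominated_def
proof (intro conjI ballI notI)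
  show "b @ [t, i] \<in> sierpinski_verts p (m + 2)"
    using assms by (auto simp: sierpinski_verts_def untouched_cliques_def)
  fix x assume x: "x \<in> X" and "b @ [t, i] \<in> total_dom (sierpinski p (m + 2)) x"
  hence adj: "sierpinski_adj (m + 2) (b @ [t, i]) x" and "x \<in> sierpinski_verts p (m + 2)"
    by (auto simp: mem_total_dom_sierpinski intro: sierpinski_adj_sym)
  then obtain c k l where c: "c \<in> sierpinski_verts p m" and "x = c @ [k, l]"
    unfolding sierpinski_verts_Suc_Suc by blast
  with adj adj_off_diagonalD[of m b t i c k l] assms(1) \<open>i \<noteq> t\<close>
  have "x = b @ [t, l] \<or> x = b @ [i, t]" by (auto simp: sierpinski_verts_def)
  with x t it show False by (auto simp: untouched_cliques_def)
qed

lemma legal_same_cliqueI: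
  assumes "undominated p m X (b @ [i, k])" "b @ [i, j] \<in> sierpinski_verts p (m + 2)" "j \<noteq> k"
  shows "b @ [i, j] \<in> legal_moves (sierpinski p (m + 2)) X"
proof -
  have "length b = m" using assms(2) by (simp add: sierpinski_verts_def)
  from adj_same_clique[OF this \<open>j \<noteq> k\<close>] assms
  have "b @ [i, k] \<in> total_dom (sierpinski p (m + 2)) (b @ [i, j])"
    by (simp add: mem_total_dom_sierpinski undominated_def)
  with assms show ?thesis
    unfolding legal_moves_def undominated_def by (auto simp: sierpinski_def)
qed

lemma legal_between_cliquesI:
  assumes "undominated p m X (b @ [t, i])" "i \<noteq> t"
  shows "b @ [i, t] \<in> legal_moves (sierpinski p (m + 2)) X"
proof -
  have "length b = m" "b @ [i, t] \<in> sierpinski_verts p (m + 2)"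
    using assms(1) by (auto simp: undominated_def sierpinski_verts_def)
  from adj_between_cliques[OF this(1) \<open>i \<noteq> t\<close>] this(2) assms
  have "b @ [t, i] \<in> total_dom (sierpinski p (m + 2)) (b @ [i, t])"
    by (simp add: mem_total_dom_sierpinski undominated_def)
  with assms \<open>b @ [i, t] \<in> _\<close> show ?thesis
    unfolding legal_moves_def undominated_def by (auto simp: sierpinski_def)
qed

text \<open>
  Let \<open>x = b @ [i, j]\<close> be the vertex by which clique \<open>i\<close> is entered, and let \<open>t\<close> be another untouched clique. If
  \<open>x\<close> is the end of the edge to clique \<open>t\<close>, then \<open>x\<close> itself is still undominated, and choosing a second
  vertex of clique \<open>i\<close> dominates it. Otherwise that edge is unused, and its end \<open>b @ [i, t]\<close> newly
  dominates \<open>b @ [t, i]\<close>.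
\<close>

lemma reply_in_same_clique:
  assumes b: "b \<in> sierpinski_verts p m" and j: "j \<in> {1..p}"
    and i: "i \<in> untouched_cliques p b X" and t: "t \<in> untouched_cliques p b X" and "t \<noteq> i"
  obtains k where "b @ [i, k] \<in> legal_moves (sierpinski p (m + 2)) (insert (b @ [i, j]) X)"
proof (cases "j = t")
  case True
  have tp: "t \<in> {1..p}" and ip: "i \<in> {1..p}" using t i by (auto simp: untouched_cliques_def)
  have "b @ [t, i] \<notin> X" using t by (simp add: untouched_cliques_def)
  with undominated_in_untouched_clique[OF b tp i \<open>t \<noteq> i\<close>] have "undominated p m X (b @ [i, t])" .
  moreover have "b @ [i, t] \<notin> total_dom (sierpinski p (m + 2)) (b @ [i, t])"
    by (auto simp: mem_total_dom_sierpinski sierpinski_adj_def)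
  ultimately have "undominated p m (insert (b @ [i, j]) X) (b @ [i, t])"
    using True by (simp add: undominated_def)
  moreover have "b @ [i, i] \<in> sierpinski_verts p (m + 2)"
    using b ip by (auto simp: sierpinski_verts_def)
  ultimately show thesis using legal_same_cliqueI[of p m _ b i t i] \<open>t \<noteq> i\<close> that by metis
next
  case False
  have ip: "i \<in> {1..p}" using i by (auto simp: untouched_cliques_def)
  have "t \<in> untouched_cliques p b (insert (b @ [i, j]) X)"
    using t \<open>t \<noteq> i\<close> by (simp add: untouched_cliques_insert)
  moreover have "b @ [i, t] \<notin> insert (b @ [i, j]) X"
    using i False by (auto simp: untouched_cliques_def)
  ultimately have "undominated p m (insert (b @ [i, j]) X) (b @ [t, i])"
    using undominated_in_untouched_clique[OF b ip] \<open>t \<noteq> i\<close> by metis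
  thus thesis using legal_between_cliquesI \<open>t \<noteq> i\<close> that by metis
qed

section \<open>The deficit\<close>

definition deficit :: "nat \<Rightarrow> nat \<Rightarrow> nat list set \<Rightarrow> nat" where
  "deficit p m X = (\<Sum>b\<in>sierpinski_verts p m. card (untouched_cliques p b X) - 1)"

lemma deficit_empty: "deficit p m {} = (p - 1) * p ^ m"
proof -
  have "sierpinski_verts p m = {xs. set xs \<subseteq> {1..p} \<and> length xs = m}"
    by (auto simp: sierpinski_verts_def)
  hence "card (sierpinski_verts p m) = p ^ m" by (simp add: card_lists_length_eq)
  moreover have "untouched_cliques p b {} = {1..p}" for b by (auto simp: untouched_cliques_def)
  ultimately show ?thesis by (simp add: deficit_def)
qed

lemma deficit_insert:
  assumes b: "b \<in> sierpinski_verts p m"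
  shows "deficit p m X = deficit p m (insert (b @ [i, j]) X) +
     of_bool (i \<in> untouched_cliques p b X \<and> 2 \<le> card (untouched_cliques p b X))"
proof -
  let ?Y = "insert (b @ [i, j]) X"
  let ?d = "\<lambda>X c. card (untouched_cliques p c X) - 1"
  have split: "deficit p m Z = ?d Z b + (\<Sum>c\<in>sierpinski_verts p m - {b}. ?d Z c)" for Z
    unfolding deficit_def by (rule sum.remove[OF finite_sierpinski_verts b])
  have "(\<Sum>c\<in>sierpinski_verts p m - {b}. ?d ?Y c) = (\<Sum>c\<in>sierpinski_verts p m - {b}. ?d X c)"
    by (rule sum.cong) (auto simp: untouched_cliques_insert)
  moreover have "?d X b = ?d ?Y b +
      of_bool (i \<in> untouched_cliques p b X \<and> 2 \<le> card (untouched_cliques p b X))"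
    using card_Diff1_le[of "untouched_cliques p b X" i]
    by (auto simp: untouched_cliques_insert)
  ultimately show ?thesis using split[of X] split[of ?Y] by linarith
qed

lemma deficit_posE:
  assumes "0 < deficit p m X"
  obtains b i t where "b \<in> sierpinski_verts p m" "i \<in> untouched_cliques p b X"
    "t \<in> untouched_cliques p b X" "t \<noteq> i"
proof -
  from assms have "(\<Sum>b\<in>sierpinski_verts p m. card (untouched_cliques p b X) - 1) \<noteq> 0"
    by (simp add: deficit_def)
  then obtain b where b: "b \<in> sierpinski_verts p m" "card (untouched_cliques p b X) - 1 \<noteq> 0"
    by (rule sum.not_neutral_contains_not_neutral)
  hence "\<not> card (untouched_cliques p b X) \<le> Suc 0" by simp
  then obtain i t where "i \<in> untouched_cliques p b X" "t \<in> untouched_cliques p b X" "t \<noteq> i"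
    by (auto simp: card_le_Suc0_iff_eq)
  with b that show thesis by blast
qed

section \<open>Gaining a tempo\<close>

definition has_tempo :: "nat \<Rightarrow> nat \<Rightarrow> nat list set \<Rightarrow> bool" where
  "has_tempo p m X \<longleftrightarrow> (\<exists>b\<in>sierpinski_verts p m. untouched_cliques p b X \<noteq> {} \<and>
     (\<exists>i\<in>{1..p} - untouched_cliques p b X. \<forall>t\<in>untouched_cliques p b X. b @ [i, t] \<notin> X))"

lemma has_tempo_imp_legal_move:
  assumes "has_tempo p m X"
  shows "legal_moves (sierpinski p (m + 2)) X \<noteq> {}"
proof -
  from assms obtain b i t where "b \<in> sierpinski_verts p m" "i \<in> {1..p}"
    "t \<in> untouched_cliques p b X" "i \<noteq> t" "b @ [i, t] \<notin> X"
    unfolding has_tempo_def by blast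
  with undominated_in_untouched_clique legal_between_cliquesI show ?thesis by blast
qed

text \<open>
  A diagonal vertex is the one vertex of its clique that is adjacent to no other clique of the
  same copy, so choosing it touches the clique without using any of the edges on which a tempo rests.
\<close>

lemma diagonal_move:
  assumes "0 < deficit p m X"
  obtains w where "w \<in> legal_moves (sierpinski p (m + 2)) X"
    "has_tempo p m (insert w X)" "deficit p m X \<le> deficit p m (insert w X) + 1"
proof -
  from assms obtain b i t where b: "b \<in> sierpinski_verts p m"
    and i: "i \<in> untouched_cliques p b X" and t: "t \<in> untouched_cliques p b X" and "t \<noteq> i"
    by (rule deficit_posE)
  let ?w = "b @ [i, i]"
  have ip: "i \<in> {1..p}" and tp: "t \<in> {1..p}" using i t by (auto simp: untouched_cliques_def)
  have "b @ [t, i] \<notin> X" using t by (simp add: untouched_cliques_def)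
  with undominated_in_untouched_clique[OF b tp i \<open>t \<noteq> i\<close>] have "undominated p m X (b @ [i, t])" .
  moreover have "?w \<in> sierpinski_verts p (m + 2)"
    using b ip by (auto simp: sierpinski_verts_def)
  ultimately have "?w \<in> legal_moves (sierpinski p (m + 2)) X"
    using legal_same_cliqueI \<open>t \<noteq> i\<close> by metis
  moreover have op: "untouched_cliques p b (insert ?w X) = untouched_cliques p b X - {i}"
    by (simp add: untouched_cliques_insert)
  have "\<forall>s\<in>untouched_cliques p b (insert ?w X). b @ [i, s] \<notin> insert ?w X"
    using i unfolding op by (auto simp: untouched_cliques_def)
  hence "has_tempo p m (insert ?w X)"
    unfolding has_tempo_def using b ip t \<open>t \<noteq> i\<close> op by blast
  moreover have "deficit p m X \<le> deficit p m (insert ?w X) + 1"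
    by (subst deficit_insert[OF b, of X i i]) simp
  ultimately show thesis by (rule that)
qed

text \<open>
  A tempo depends on one touched clique and on all the untouched cliques of the same copy. Two moves
  in a newly entered clique do not affect the former and remove only one of the latter; another one
  remains.
\<close>

lemma has_tempo_preserved:
  assumes tempo: "has_tempo p m X"
    and i: "i \<in> untouched_cliques p b X" and t: "t \<in> untouched_cliques p b X" and "t \<noteq> i"
  shows "has_tempo p m (insert (b @ [i, k]) (insert (b @ [i, j]) X))" (is "has_tempo p m ?Y")
proof -
  from tempo obtain c s where c: "c \<in> sierpinski_verts p m" "untouched_cliques p c X \<noteq> {}"
    and s: "s \<in> {1..p} - untouched_cliques p c X" "\<forall>u\<in>untouched_cliques p c X. c @ [s, u] \<notin> X"
    unfolding has_tempo_def by (elim bexE conjE)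
  have op: "untouched_cliques p c ?Y = (if c = b then untouched_cliques p b X - {i} else untouched_cliques p c X)"
    by (simp add: untouched_cliques_insert)
  have sub: "untouched_cliques p c ?Y \<subseteq> untouched_cliques p c X" unfolding op by auto
  have ne: "untouched_cliques p c ?Y \<noteq> {}" unfolding op using c t \<open>t \<noteq> i\<close> by auto
  have s_touched: "s \<in> {1..p} - untouched_cliques p c ?Y" using sub s(1) by blast
  have "c @ [s, u] \<noteq> b @ [i, l]" for u l using s(1) i by auto
  hence unused: "\<forall>u\<in>untouched_cliques p c ?Y. c @ [s, u] \<notin> ?Y" using sub s(2) by blast
  show ?thesis unfolding has_tempo_def
  proof (rule bexI[OF _ c(1)], rule conjI[OF ne])
    show "\<exists>i\<in>{1..p} - untouched_cliques p c ?Y. \<forall>t\<in>untouched_cliques p c ?Y. c @ [i, t] \<notin> ?Y"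
      using unused s_touched by (rule bexI)
  qed
qed

section \<open>Playing the game\<close>

lemma tdg_moves_Dominator_ge:
  assumes "finite (pverts G)" "legal_moves G X \<noteq> {}"
    and "\<And>v. v \<in> legal_moves G X \<Longrightarrow> c \<le> 1 + tdg_moves G Staller (insert v X)"
  shows "c \<le> tdg_moves G Dominator X"
proof -
  have "finite (legal_moves G X)" using assms(1) by (simp add: legal_moves_def)
  with assms show ?thesis by (simp add: tdg_moves.simps(1)[of G X])
qed

lemma tdg_moves_Staller_ge:
  assumes "finite (pverts G)" "v \<in> legal_moves G X"
  shows "1 + tdg_moves G Dominator (insert v X) \<le> tdg_moves G Staller X"
proof -
  have "finite (legal_moves G X)" using assms(1) by (simp add: legal_moves_def)
  hence "1 + tdg_moves G Dominator (insert v X) \<le>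
      Max ((\<lambda>v. 1 + tdg_moves G Dominator (insert v X)) ` legal_moves G X)"
    using assms(2) by (intro Max_ge) auto
  thus ?thesis using assms by (auto simp: tdg_moves.simps(2)[of G X])
qed

lemma tdg_moves_lower_bound:
  "2 * deficit p m X + of_bool (has_tempo p m X) \<le>
     tdg_moves (sierpinski p (m + 2)) Dominator X"
proof (induction "card (sierpinski_verts p (m + 2) - X)" arbitrary: X rule: less_induct)
  case less
  let ?G = "sierpinski p (m + 2)"
  have verts: "pverts ?G = sierpinski_verts p (m + 2)" by (simp add: sierpinski_def)
  have fin: "finite (pverts ?G)" unfolding verts by (rule finite_sierpinski_verts)
  \<comment> \<open>One round: the bound after Staller's reply \<open>y\<close> carries over to the position after Dominator's \<open>v\<close>.\<close>
  have round: "2 + 2 * deficit p m (insert y (insert v X)) +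
       of_bool (has_tempo p m (insert y (insert v X))) \<le> 1 + tdg_moves ?G Staller (insert v X)"
    if v: "v \<in> legal_moves ?G X" and y: "y \<in> legal_moves ?G (insert v X)" for v y
  proof -
    have "sierpinski_verts p (m + 2) - insert y (insert v X) \<subset> sierpinski_verts p (m + 2) - X"
      using legal_moves_fresh[OF v] unfolding verts by blast
    hence "card (sierpinski_verts p (m + 2) - insert y (insert v X))
        < card (sierpinski_verts p (m + 2) - X)"
      by (intro psubset_card_mono) (simp_all add: finite_sierpinski_verts)
    from less[OF this] tdg_moves_Staller_ge[OF fin y] show ?thesis by linarith
  qed
  show ?case
  proof (cases "deficit p m X = 0 \<and> \<not> has_tempo p m X")
    case False
    show ?thesis
    proof (rule tdg_moves_Dominator_ge[OF fin])
      show "legal_moves ?G X \<noteq> {}"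
      proof (cases "has_tempo p m X")
        case True
        thus ?thesis by (rule has_tempo_imp_legal_move)
      next
        case no_tempo: False
        with False have "0 < deficit p m X" by simp
        then obtain w where "w \<in> legal_moves ?G X" by (rule diagonal_move)
        thus ?thesis by blast
      qed
    next
      fix v assume v: "v \<in> legal_moves ?G X"
      have "v \<in> sierpinski_verts p (m + 2)" using legal_moves_fresh[OF v] unfolding verts by simp
      then obtain b i j where b: "b \<in> sierpinski_verts p m" and j: "j \<in> {1..p}"
        and v_eq: "v = b @ [i, j]"
        unfolding sierpinski_verts_Suc_Suc by blast
      show "2 * deficit p m X + of_bool (has_tempo p m X) \<le> 1 + tdg_moves ?G Staller (insert v X)"
      proof (cases "i \<in> untouched_cliques p b X \<and> 2 \<le> card (untouched_cliques p b X)")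
        case True
        hence i: "i \<in> untouched_cliques p b X" and "\<not> card (untouched_cliques p b X) \<le> Suc 0" by auto
        hence "\<not> untouched_cliques p b X \<subseteq> {i}" using card_mono[of "{i}" "untouched_cliques p b X"] by auto
        then obtain t where t: "t \<in> untouched_cliques p b X" "t \<noteq> i" by blast
        from reply_in_same_clique[OF b j i t] obtain k
          where k: "b @ [i, k] \<in> legal_moves ?G (insert v X)" unfolding v_eq by blast
        have "deficit p m X = deficit p m (insert v X) + 1"
          using deficit_insert[OF b, of X i j] True v_eq by simp
        moreover have "deficit p m (insert v X) = deficit p m (insert (b @ [i, k]) (insert v X))"
          using deficit_insert[OF b, of "insert v X" i k] v_eq by (simp add: untouched_cliques_insert)
        moreover have "has_tempo p m (insert (b @ [i, k]) (insert v X))" if "has_tempo p m X"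
          unfolding v_eq by (rule has_tempo_preserved[OF that i t])
        ultimately show ?thesis using round[OF v k] by (cases "has_tempo p m X") simp_all
      next
        case neutral: False
        have same: "deficit p m (insert v X) = deficit p m X"
          using deficit_insert[OF b, of X i j] neutral v_eq by auto
        show ?thesis
        proof (cases "deficit p m X = 0")
          case False
          with same have "0 < deficit p m (insert v X)" by simp
          then obtain w where w: "w \<in> legal_moves ?G (insert v X)"
            "has_tempo p m (insert w (insert v X))"
            "deficit p m (insert v X) \<le> deficit p m (insert w (insert v X)) + 1"
            by (rule diagonal_move)
          have "of_bool (has_tempo p m X) \<le> (1::nat)" by simp
          with round[OF v w(1)] w(2,3) same show ?thesis by simp
        qed simp
      qed
    qed
  qed simp
qed

theorem theorem4p2:
  fixes p n :: nat
  assumes "p \<ge> 3" and "n \<ge> 2"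
  shows "gamma_tg (sierpinski p n) \<ge> (2 * p - 2) * p ^ (n - 2) \<and>
         gamma_tg' (sierpinski p n) \<ge> (2 * p - 2) * p ^ (n - 2)"
proof -
  define m where "m = n - 2"
  have n: "n = m + 2" using assms(2) by (simp add: m_def)
  have target: "(2 * p - 2) * p ^ (n - 2) = 2 * deficit p m {}"
    by (simp add: deficit_empty n algebra_simps)
  have "2 * deficit p m {} \<le> gamma_tg (sierpinski p n)"
    using tdg_moves_lower_bound[of p m "{}"] by (simp add: gamma_tg_def n)
  moreover have "2 * deficit p m {} \<le> gamma_tg' (sierpinski p n)"
  proof -
    have "0 < deficit p m {}" using assms(1) by (simp add: deficit_empty)
    then obtain w where w: "w \<in> legal_moves (sierpinski p (m + 2)) {}"
      "has_tempo p m {w}" "deficit p m {} \<le> deficit p m {w} + 1"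
      by (rule diagonal_move)
    have "finite (pverts (sierpinski p (m + 2)))"
      by (simp add: sierpinski_def finite_sierpinski_verts)
    from tdg_moves_Staller_ge[OF this w(1)] tdg_moves_lower_bound[of p m "{w}"] w(2,3)
    show ?thesis by (simp add: gamma_tg'_def n)
  qed
  ultimately show ?thesis unfolding target by blast
qed

end
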